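(* Let $n\ge 2$ and let $\mathfrak{L}$ be a finite-dimensional Leibniz algebra over a field $\mathbb{K}$ of characteristic zero. The Leibniz $n$-algebra $\mathbf{U}_n(\mathfrak{L})$ is semisimple (that is, $\mathrm{Rad}(\mathbf{U}_n(\mathfrak{L}))=\{0\}$) if and only if $\mathfrak{L}$ is a semisimple Lie algebra.
   Context: A Leibniz algebra is a vector space $\mathfrak{L}$ with a bilinear bracket satisfying $[[x,y],z]=[[x,z],y]+[x,[y,z]]$; it is a Lie algebra exactly when $[x,x]=0$ for all $x$. A Leibniz $n$-algebra is a vector space $L$ with an $n$-linear bracket satisfying $[[x_1,\ldots,x_n],y_1,\ldots,y_{n-1}]=\sum_{i=1}^{n}[x_1,\ldots,x_{i-1},[x_i,y_1,\ldots,y_{n-1}],x_{i+1},\ldots,x_n]$. For a Leibniz algebra $\mathfrak{L}$, $\mathbf{U}_n(\mathfrak{L})$ is the Leibniz $n$-algebra on the same vector space with bracket $[x_1,\dots,x_n]=[x_1,[\dots,[x_{n-2},[x_{n-1},x_n]]\dots]]$. An ideal of $L$ is a subspace $I$ such that for every $1\le s\le n$ one has $[L,\dots,L,I,L,\dots,L]\subseteq I$ with $I$ in position $s$. An ideal $H$ of $L$ is solvable (i.e. $n$-solvable) if $H^{(m)_n}=0$ for some $m\ge1$, where $H^{(1)_n}=H$ and $H^{(m+1)_n}=[H^{(m)_n},\dots,H^{(m)_n}]$ (the span of all $n$-ary brackets of elements of $H^{(m)_n}$). $\mathrm{Rad}(L)$ is the maximal solvable ideal of $L$, and $L$ is called semisimple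 if $\mathrm{Rad}(L)=\{0\}$. A Lie algebra is semisimple if its solvable radical is zero. *)

theory Defs
  imports Complex_Main
begin

subsection \<open>Leibniz algebras and Lie algebras\<close>

locale leibniz_algebra = vector_space scale
  for scale :: "'k::field \<Rightarrow> 'v::ab_group_add \<Rightarrow> 'v" +
  fixes bracket :: "'v \<Rightarrow> 'v \<Rightarrow> 'v"
  assumes linear_left: "Vector_Spaces.linear scale scale (\<lambda>x. bracket x y)"
    and linear_right: "Vector_Spaces.linear scale scale (\<lambda>y. bracket x y)"
    and leibniz_identity:
      "bracket (bracket x y) z = bracket (bracket x z) y + bracket x (bracket y z)"

locale lie_algebra = leibniz_algebra scale bracket
  for scale :: "'k::field \<Rightarrow> 'v::ab_group_add \<Rightarrow> 'v" and bracket :: "'v \<Rightarrow> 'v \<Rightarrow> 'v" +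
  assumes bracket_self: "bracket x x = 0"
begin

definition lie_ideal :: "'v set \<Rightarrow> bool" where
  "lie_ideal I \<longleftrightarrow> subspace I \<and> (\<forall>x. \<forall>y\<in>I. bracket x y \<in> I \<and> bracket y x \<in> I)"

primrec lie_derived :: "'v set \<Rightarrow> nat \<Rightarrow> 'v set" where
  "lie_derived H 0 = H"
| "lie_derived H (Suc m) = span {bracket x y | x y. x \<in> lie_derived H m \<and> y \<in> lie_derived H m}"

definition lie_solvable_ideal :: "'v set \<Rightarrow> bool" where
  "lie_solvable_ideal I \<longleftrightarrow> lie_ideal I \<and> (\<exists>m. lie_derived I m = {0})"

text \<open>The radical is the maximal solvable ideal, that is, the one containing every solvable
  ideal. In finite dimension it exists: see \<open>is_lie_Rad\<close>, and \<open>is_Rad\<close> for the n-ary case.\<close>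

definition lie_Rad :: "'v set" where
  "lie_Rad = (THE R. lie_solvable_ideal R \<and> (\<forall>I. lie_solvable_ideal I \<longrightarrow> I \<subseteq> R))"

end

locale semisimple_lie_algebra = lie_algebra +
  assumes lie_Rad_zero: "lie_Rad = {0}"


subsection \<open>Leibniz n-algebras\<close>

text \<open>The arguments of the n-ary bracket form a list, of which only the lists of length \<open>n\<close>
  matter; positions are counted from \<open>0\<close>.\<close>

locale leibniz_n_algebra = vector_space scale
  for scale :: "'k::field \<Rightarrow> 'v::ab_group_add \<Rightarrow> 'v" +
  fixes n :: nat and nbracket :: "'v list \<Rightarrow> 'v"
  assumes arity: "2 \<le> n"
    and multilinear: "length xs = n \<Longrightarrow> s < n \<Longrightarrow>
      Vector_Spaces.linear scale scale (\<lambda>x. nbracket (xs[s := x]))"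
    and n_leibniz_identity: "length xs = n \<Longrightarrow> length ys = n - 1 \<Longrightarrow>
      nbracket (nbracket xs # ys) = (\<Sum>i<n. nbracket (xs[i := nbracket (xs ! i # ys)]))"
begin

definition n_ideal :: "'v set \<Rightarrow> bool" where
  "n_ideal I \<longleftrightarrow> subspace I \<and>
    (\<forall>s<n. \<forall>xs. length xs = n \<longrightarrow> xs ! s \<in> I \<longrightarrow> nbracket xs \<in> I)"

text \<open>With the usual indexing from \<open>1\<close>, \<open>n_derived H m\<close> is the term of index \<open>m + 1\<close>
  of the derived series of \<open>H\<close>.\<close>

primrec n_derived :: "'v set \<Rightarrow> nat \<Rightarrow> 'v set" where
  "n_derived H 0 = H"
| "n_derived H (Suc m) = span {nbracket xs | xs. length xs = n \<and> set xs \<subseteq> n_derived H m}"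

definition n_solvable_ideal :: "'v set \<Rightarrow> bool" where
  "n_solvable_ideal I \<longleftrightarrow> n_ideal I \<and> (\<exists>m. n_derived I m = {0})"

definition Rad :: "'v set" where
  "Rad = (THE R. n_solvable_ideal R \<and> (\<forall>I. n_solvable_ideal I \<longrightarrow> I \<subseteq> R))"

definition semisimple :: bool where
  "semisimple \<longleftrightarrow> Rad = {0}"

end


subsection \<open>The Leibniz n-algebra of a Leibniz algebra\<close>

text \<open>\<open>U_bracket br [x\<^sub>1, \<dots>, x\<^sub>n] = br x\<^sub>1 (br x\<^sub>2 (\<dots> (br x\<^sub>n\<^sub>-\<^sub>1 x\<^sub>n)))\<close>; the value on \<open>[]\<close> is a
  dummy.\<close>

fun U_bracket :: "('v::zero \<Rightarrow> 'v \<Rightarrow> 'v) \<Rightarrow> 'v list \<Rightarrow> 'v" where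
  "U_bracket br [] = 0"
| "U_bracket br [x] = x"
| "U_bracket br (x # y # zs) = br x (U_bracket br (y # zs))"

context leibniz_algebra
begin

lemma U_bracket_Cons: "xs \<noteq> [] \<Longrightarrow> U_bracket bracket (x # xs) = bracket x (U_bracket bracket xs)"
  by (cases xs) auto

lemma linear_U_bracket:
  "s < length xs \<Longrightarrow> Vector_Spaces.linear scale scale (\<lambda>x. U_bracket bracket (xs[s := x]))"
proof (induction xs arbitrary: s)
  case Nil
  then show ?case by simp
next
  case (Cons a xs)
  show ?case
  proof (cases s)
    case 0
    then show ?thesis
      using linear_left linear_ident by (cases "xs = []") (auto simp: U_bracket_Cons)
  next
    case (Suc t)
    then have t: "t < length xs" and ne: "\<And>x. xs[t := x] \<noteq> []"
      using Cons.prems by auto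
    have "Vector_Spaces.linear scale scale
        (bracket a \<circ> (\<lambda>x. U_bracket bracket (xs[t := x])))"
      by (rule Vector_Spaces.linear_compose[OF Cons.IH[OF t]]) (rule linear_right)
    then show ?thesis
      using ne by (simp add: Suc U_bracket_Cons o_def)
  qed
qed

lemma derivation_U_bracket:
  "xs \<noteq> [] \<Longrightarrow> bracket (U_bracket bracket xs) y
     = (\<Sum>i<length xs. U_bracket bracket (xs[i := bracket (xs ! i) y]))"
proof (induction xs)
  case Nil
  then show ?case by simp
next
  case (Cons a xs)
  show ?case
  proof (cases "xs = []")
    case True
    then show ?thesis by simp
  next
    case False
    interpret R: Vector_Spaces.linear scale scale "bracket a" by (rule linear_right)
    have ne: "\<And>i x. xs[i := x] \<noteq> []" using False by simp
    have "bracket (U_bracket bracket (a # xs)) y = bracket (bracket a y) (U_bracket bracket xs)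
        + bracket a (bracket (U_bracket bracket xs) y)"
      using False by (simp only: U_bracket_Cons not_False_eq_True) (rule leibniz_identity)
    also have "bracket a (bracket (U_bracket bracket xs) y)
        = (\<Sum>i<length xs. bracket a (U_bracket bracket (xs[i := bracket (xs ! i) y])))"
      using Cons.IH[OF False] by (simp add: R.sum)
    finally show ?thesis
      using False ne
      by (simp add: sum.lessThan_Suc_shift U_bracket_Cons del: sum.lessThan_Suc)
  qed
qed

lemma leibniz_n_algebra_U:
  assumes "2 \<le> n"
  shows "leibniz_n_algebra scale n (U_bracket bracket)"
proof (intro leibniz_n_algebra.intro leibniz_n_algebra_axioms.intro)
  show "vector_space scale" by (rule vector_space_axioms)
next
  show "2 \<le> n" by fact
next
  fix xs :: "'v list" and s
  assume "length xs = n" "s < n"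
  then show "Vector_Spaces.linear scale scale (\<lambda>x. U_bracket bracket (xs[s := x]))"
    by (simp add: linear_U_bracket)
next
  fix xs ys :: "'v list"
  assume xs: "length xs = n" and ys: "length ys = n - 1"
  have "xs \<noteq> []" "ys \<noteq> []" using xs ys assms by auto
  then show "U_bracket bracket (U_bracket bracket xs # ys)
      = (\<Sum>i<n. U_bracket bracket (xs[i := U_bracket bracket (xs ! i # ys)]))"
    by (simp add: U_bracket_Cons derivation_U_bracket xs)
qed

end


subsection \<open>Existence of the radical\<close>

lemma (in finite_dimensional_vector_space) ex_greatest_subspace:
  assumes zero: "P {0}"
    and sub: "\<And>I. P I \<Longrightarrow> subspace I"
    and sums: "\<And>I J. P I \<Longrightarrow> P J \<Longrightarrow> P {x + y | x y. x \<in> I \<and> y \<in> J}"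
  shows "\<exists>!R. P R \<and> (\<forall>I. P I \<longrightarrow> I \<subseteq> R)"
proof -
  have "\<exists>R. P R \<and> (\<forall>I. P I \<longrightarrow> dim I \<le> dim R)"
    using ex_has_greatest_nat[of P "{0}" dim "Suc dimension"] zero dim_subset_UNIV
    by (meson le_imp_less_Suc less_imp_le)
  then obtain R where R: "P R" and max: "\<And>I. P I \<Longrightarrow> dim I \<le> dim R" by blast
  have "I \<subseteq> R" if I: "P I" for I
  proof -
    let ?S = "{x + y | x y. x \<in> R \<and> y \<in> I}"
    have PS: "P ?S" by (rule sums[OF R I])
    have "R \<subseteq> ?S" using subspace_0[OF sub[OF I]] by force
    then have "R = ?S"
      using subspace_dim_equal[OF sub[OF R] sub[OF PS]] max[OF PS] by blast
    moreover have "I \<subseteq> ?S" using subspace_0[OF sub[OF R]] by force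
    ultimately show ?thesis by simp
  qed
  with R show ?thesis by (intro ex1I[of _ R]) auto
qed

context leibniz_n_algebra
begin

lemma n_derived_mono: "H \<subseteq> K \<Longrightarrow> n_derived H m \<subseteq> n_derived K m"
proof (induction m)
  case (Suc m)
  then show ?case by (auto intro!: span_mono)
qed simp

lemma n_derived_add: "n_derived H (m + k) = n_derived (n_derived H m) k"
  by (induction k) auto

lemma subspace_n_derived: "subspace H \<Longrightarrow> subspace (n_derived H m)"
  by (cases m) auto

lemma nbracket_diff:
  assumes "length xs = n" "s < n"
  shows "nbracket (xs[s := x]) - nbracket (xs[s := y]) = nbracket (xs[s := x - y])"
proof -
  interpret T: Vector_Spaces.linear scale scale "\<lambda>x. nbracket (xs[s := x])"
    by (rule multilinear[OF assms])
  show ?thesis by (simp add: T.diff)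
qed

lemma nbracket_congruent:
  assumes J: "n_ideal J" and xs: "length xs = n" and as: "length as = n"
    and diff: "\<And>i. i < n \<Longrightarrow> xs ! i - as ! i \<in> J"
  shows "nbracket xs - nbracket as \<in> J"
proof -
  have sJ: "subspace J" using J by (simp add: n_ideal_def)
  have "nbracket xs - nbracket (take k as @ drop k xs) \<in> J" if "k \<le> n" for k
    using that
  proof (induction k)
    case 0
    then show ?case using sJ by (simp add: subspace_0)
  next
    case (Suc k)
    let ?l = "take k as @ drop k xs"
    have k: "k < n" and l: "length ?l = n" using Suc.prems xs as by auto
    have 1: "?l[k := xs ! k] = ?l"
      using k xs as by (intro nth_equalityI) (auto simp: nth_list_update nth_append)
    have 2: "?l[k := as ! k] = take (Suc k) as @ drop (Suc k) xs"
      using k xs as by (intro nth_equalityI) (auto simp: nth_list_update nth_append less_Suc_eq)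
    have "nbracket (?l[k := xs ! k - as ! k]) \<in> J"
      using J k l diff[OF k] by (auto simp: n_ideal_def)
    then have "nbracket ?l - nbracket (take (Suc k) as @ drop (Suc k) xs) \<in> J"
      using nbracket_diff[OF l k, of "xs ! k" "as ! k"] 1 2 by simp
    with Suc.IH k have "(nbracket xs - nbracket ?l)
        + (nbracket ?l - nbracket (take (Suc k) as @ drop (Suc k) xs)) \<in> J"
      by (intro subspace_add[OF sJ]) auto
    then show ?case by simp
  qed
  from this[of n] show ?thesis using xs as by simp
qed

lemma n_ideal_sums:
  assumes I: "n_ideal I" and J: "n_ideal J"
  shows "n_ideal {x + y | x y. x \<in> I \<and> y \<in> J}" (is "n_ideal ?S")
proof -
  have "nbracket xs \<in> ?S" if s: "s < n" and xs: "length xs = n" and m: "xs ! s \<in> ?S" for s xs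
  proof -
    obtain a b where ab: "xs ! s = a + b" "a \<in> I" "b \<in> J" using m by blast
    have "nbracket (xs[s := a]) \<in> I" "nbracket (xs[s := b]) \<in> J"
      using I J ab s xs by (auto simp: n_ideal_def)
    moreover have "nbracket xs = nbracket (xs[s := a]) + nbracket (xs[s := b])"
      using nbracket_diff[OF xs s, of "xs ! s" a] ab list_update_id[of xs s]
      by (simp add: algebra_simps)
    ultimately show ?thesis by blast
  qed
  then show ?thesis
    using I J subspace_sums[of I J] by (auto simp: n_ideal_def)
qed

lemma n_derived_sums:
  assumes I: "subspace I" and J: "n_ideal J"
  shows "n_derived {x + y | x y. x \<in> I \<and> y \<in> J} m \<subseteq> {x + y | x y. x \<in> n_derived I m \<and> y \<in> J}"
proof (induction m)
  case 0
  then show ?case by simp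
next
  case (Suc m)
  let ?A = "n_derived I m"
  let ?T = "{x + y | x y. x \<in> n_derived I (Suc m) \<and> y \<in> J}"
  have sJ: "subspace J" using J by (simp add: n_ideal_def)
  have T: "subspace ?T"
    using subspace_sums[OF subspace_n_derived[OF I] sJ] .
  have "nbracket xs \<in> ?T"
    if xs: "length xs = n" and sub: "set xs \<subseteq> {x + y | x y. x \<in> ?A \<and> y \<in> J}" for xs
  proof -
    have "\<forall>i<n. \<exists>a. a \<in> ?A \<and> xs ! i - a \<in> J"
    proof (intro allI impI)
      fix i assume "i < n"
      then have "xs ! i \<in> {x + y | x y. x \<in> ?A \<and> y \<in> J}" using xs sub by (auto dest: nth_mem)
      then show "\<exists>a. a \<in> ?A \<and> xs ! i - a \<in> J" by force
    qed
    then obtain f where f: "\<And>i. i < n \<Longrightarrow> f i \<in> ?A \<and> xs ! i - f i \<in> J" by metis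
    let ?as = "map f [0..<n]"
    have "nbracket xs - nbracket ?as \<in> J"
      using f xs by (intro nbracket_congruent[OF J]) auto
    moreover have "nbracket ?as \<in> n_derived I (Suc m)"
      using f by (auto intro!: span_base exI[of _ ?as])
    moreover have "nbracket xs = nbracket ?as + (nbracket xs - nbracket ?as)" by simp
    ultimately show ?thesis by blast
  qed
  then have "{nbracket xs | xs. length xs = n \<and>
      set xs \<subseteq> n_derived {x + y | x y. x \<in> I \<and> y \<in> J} m} \<subseteq> ?T"
    using Suc.IH by blast
  then show ?case
    using span_minimal[OF _ T] by simp
qed

lemma n_solvable_ideal_sums:
  assumes "n_solvable_ideal I" "n_solvable_ideal J"
  shows "n_solvable_ideal {x + y | x y. x \<in> I \<and> y \<in> J}" (is "n_solvable_ideal ?S")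
proof -
  from assms obtain m k where I: "n_ideal I" and J: "n_ideal J"
    and m: "n_derived I m = {0}" and k: "n_derived J k = {0}"
    by (auto simp: n_solvable_ideal_def)
  have S: "n_ideal ?S" by (rule n_ideal_sums[OF I J])
  have sI: "subspace I" using I by (simp add: n_ideal_def)
  have "n_derived ?S m \<subseteq> J"
    using n_derived_sums[OF sI J, of m] m by auto
  then have "n_derived ?S (m + k) \<subseteq> {0}"
    using n_derived_mono[of "n_derived ?S m" J k] k by (simp add: n_derived_add)
  moreover have "0 \<in> n_derived ?S (m + k)"
    using S by (intro subspace_0 subspace_n_derived) (simp add: n_ideal_def)
  ultimately have "n_derived ?S (m + k) = {0}" by blast
  then show ?thesis using S unfolding n_solvable_ideal_def by blast
qed

lemma n_solvable_ideal_zero: "n_solvable_ideal {0}"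
proof -
  have "nbracket xs = 0" if xs: "length xs = n" and s: "s < n" and 0: "xs ! s = 0" for xs s
    using nbracket_diff[OF xs s, of 0 0] 0 list_update_id[of xs s] by simp
  then show ?thesis
    by (auto simp: n_solvable_ideal_def n_ideal_def intro: exI[of _ 0])
qed

lemma is_Rad:
  assumes "finite_dimensional_vector_space scale Basis"
  shows "n_solvable_ideal Rad \<and> (\<forall>I. n_solvable_ideal I \<longrightarrow> I \<subseteq> Rad)"
proof -
  interpret F: finite_dimensional_vector_space scale Basis by fact
  have "\<exists>!R. n_solvable_ideal R \<and> (\<forall>I. n_solvable_ideal I \<longrightarrow> I \<subseteq> R)"
    by (rule F.ex_greatest_subspace)
      (auto simp: n_solvable_ideal_zero intro: n_solvable_ideal_sums,
        auto simp: n_solvable_ideal_def n_ideal_def)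
  then show ?thesis
    unfolding Rad_def by (rule theI')
qed

end

context lie_algebra
begin

lemma lie_ideal_iff: "lie_ideal I \<longleftrightarrow> leibniz_n_algebra.n_ideal scale 2 (U_bracket bracket) I"
proof -
  interpret U: leibniz_n_algebra scale 2 "U_bracket bracket"
    by (rule leibniz_n_algebra_U) simp
  have len: "(\<forall>xs. length xs = 2 \<longrightarrow> Q xs) \<longleftrightarrow> (\<forall>x y. Q [x, y])" for Q :: "'v list \<Rightarrow> bool"
    by (auto simp: numeral_2_eq_2 length_Suc_conv)
  have pos: "(\<forall>s<2. Q s) \<longleftrightarrow> Q 0 \<and> Q 1" for Q :: "nat \<Rightarrow> bool"
    by (auto simp: numeral_2_eq_2 less_Suc_eq)
  show ?thesis
    unfolding lie_ideal_def U.n_ideal_def len pos by auto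
qed

lemma lie_derived_eq:
  "lie_derived H m = leibniz_n_algebra.n_derived scale 2 (U_bracket bracket) H m"
proof -
  interpret U: leibniz_n_algebra scale 2 "U_bracket bracket"
    by (rule leibniz_n_algebra_U) simp
  show ?thesis
  proof (induction m)
    case (Suc m)
    have "{bracket x y | x y. x \<in> A \<and> y \<in> A}
        = {U_bracket bracket xs | xs. length xs = 2 \<and> set xs \<subseteq> A}" for A
    proof (intro equalityI subsetI)
      fix z assume "z \<in> {bracket x y | x y. x \<in> A \<and> y \<in> A}"
      then obtain x y where "z = bracket x y" "x \<in> A" "y \<in> A" by blast
      then show "z \<in> {U_bracket bracket xs | xs. length xs = 2 \<and> set xs \<subseteq> A}"
        by (auto intro!: exI[of _ "[x, y]"])
    qed (auto simp: numeral_2_eq_2 length_Suc_conv, blast)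
    then show ?case using Suc by simp
  qed simp
qed

lemma is_lie_Rad:
  assumes "finite_dimensional_vector_space scale Basis"
  shows "lie_solvable_ideal lie_Rad \<and> (\<forall>I. lie_solvable_ideal I \<longrightarrow> I \<subseteq> lie_Rad)"
proof -
  interpret U: leibniz_n_algebra scale 2 "U_bracket bracket"
    by (rule leibniz_n_algebra_U) simp
  have eq: "lie_solvable_ideal = U.n_solvable_ideal"
    by (simp add: fun_eq_iff lie_solvable_ideal_def U.n_solvable_ideal_def lie_ideal_iff
        lie_derived_eq)
  show ?thesis
    using U.is_Rad[OF assms] unfolding eq lie_Rad_def U.Rad_def .
qed

end

end

theory Submission
  imports Defs
begin

text \<open>Suppose first that the n-ary bracket is semisimple. The squares \<open>[x, x]\<close> span an ideal whose
  n-fold brackets vanish (\<open>squares_n_solvable\<close>), so they are zero and the algebra is a Lie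
  algebra. Its radical is also an ideal for the n-ary bracket, and is solvable there because nested
  n-fold brackets involve at least one binary bracket (\<open>n_derived_subset_lie_derived\<close>); so it is
  zero.

  For the converse, let \<open>I\<close> be a solvable ideal for the n-ary bracket of a semisimple Lie algebra.
  The obstacle is that only \<open>[I, P] \<subseteq> I\<close> is known, where \<open>P\<close> is the ideal spanned by nested
  \<open>(n - 1)\<close>-fold brackets. That \<open>P\<close> is everything (semisimple Lie algebras being perfect) is
  usually derived from the Killing form; two more elementary facts suffice.

  First, \<open>P\<close> has no nonzero solvable ideal (\<open>ideal_of_solvable_zero\<close>), since its
  radical is stable under derivations. Concretely, if \<open>d\<close> is a derivation and \<open>R\<close> a solvable ideal
  of \<open>P\<close>, then applying \<open>d\<^sup>N\<close> with \<open>N = 2\<^sup>k\<close> to a \<open>k\<close>-fold derived word in elements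
  \<open>x\<^sub>1, \<dots>, x\<^sub>N\<close> of \<open>R\<close> yields \<open>N!\<close> times the same word in \<open>d x\<^sub>1, \<dots>, d x\<^sub>N\<close>, plus words that
  lie in \<open>R\<close> because one of their letters is not differentiated. If the words of this shape vanish
  on \<open>R\<close>, and \<open>N!\<close> is invertible, the words in the \<open>d x\<^sub>i\<close> lie in \<open>R\<close>; so \<open>R + dR\<close> is
  solvable (\<open>lie_derived_plus_derivative\<close>). This is where characteristic zero enters.

  Second, \<open>I \<inter> P\<close> is then zero, being solvable also for the binary bracket
  (\<open>lie_derived_subset_n_derived\<close>), so \<open>I\<close> centralizes \<open>P\<close>. The centralizer of \<open>P\<close> is a nilpotent
  ideal, hence zero (\<open>n_solvable_zero_if_no_lie_solvable\<close>).\<close>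


section \<open>Bilinearity\<close>

context leibniz_algebra
begin

lemma bracket_add_left: "bracket (x + y) z = bracket x z + bracket y z"
proof -
  interpret T: Vector_Spaces.linear scale scale "\<lambda>x. bracket x z" by (rule linear_left)
  show ?thesis by (rule T.add)
qed

lemma bracket_add_right: "bracket z (x + y) = bracket z x + bracket z y"
proof -
  interpret T: Vector_Spaces.linear scale scale "bracket z" by (rule linear_right)
  show ?thesis by (rule T.add)
qed

lemma bracket_scale_left: "bracket (scale c x) z = scale c (bracket x z)"
proof -
  interpret T: Vector_Spaces.linear scale scale "\<lambda>x. bracket x z" by (rule linear_left)
  show ?thesis by (rule T.scale)
qed

lemma bracket_scale_right: "bracket z (scale c x) = scale c (bracket z x)"
proof -
  interpret T: Vector_Spaces.linear scale scale "bracket z" by (rule linear_right)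
  show ?thesis by (rule T.scale)
qed

lemma bracket_zero_left [simp]: "bracket 0 z = 0"
  using bracket_scale_left[of 0 0 z] by simp

lemma bracket_zero_right [simp]: "bracket z 0 = 0"
  using bracket_scale_right[of z 0 0] by simp

lemma bracket_span_right:
  assumes S: "subspace S" and y: "y \<in> span B" and B: "\<And>b. b \<in> B \<Longrightarrow> bracket x b \<in> S"
  shows "bracket x y \<in> S"
  using y
  by (induction rule: span_induct_alt)
    (auto simp: bracket_add_right bracket_scale_right S subspace_0 subspace_add subspace_scale B)

lemma bracket_span_left:
  assumes S: "subspace S" and x: "x \<in> span A" and A: "\<And>a. a \<in> A \<Longrightarrow> bracket a y \<in> S"
  shows "bracket x y \<in> S"
  using x
  by (induction rule: span_induct_alt)
    (auto simp: bracket_add_left bracket_scale_left S subspace_0 subspace_add subspace_scale A)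


section \<open>Ideals of a Leibniz algebra and of its n-ary bracket\<close>

lemma U_bracket_in_ideal:
  assumes I: "\<And>x y. y \<in> I \<Longrightarrow> bracket x y \<in> I \<and> bracket y x \<in> I"
  shows "s < length xs \<Longrightarrow> xs ! s \<in> I \<Longrightarrow> U_bracket bracket xs \<in> I"
proof (induction xs arbitrary: s)
  case (Cons a xs)
  then show ?case
    using I by (cases s; cases "xs = []") (auto simp: U_bracket_Cons)
qed simp

lemma n_ideal_U:
  assumes "2 \<le> n" and "subspace I"
    and "\<And>x y. y \<in> I \<Longrightarrow> bracket x y \<in> I \<and> bracket y x \<in> I"
  shows "leibniz_n_algebra.n_ideal scale n (U_bracket bracket) I"
proof -
  interpret U: leibniz_n_algebra scale n "U_bracket bracket"
    using assms(1) by (rule leibniz_n_algebra_U)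
  show ?thesis
    unfolding U.n_ideal_def using assms U_bracket_in_ideal by auto
qed

lemma bracket_square_right: "bracket x (bracket y y) = 0"
  using leibniz_identity[of x y y] by simp

text \<open>By \<open>bracket_square_right\<close> a nested bracket of elements of this span vanishes already at its
  innermost position, so a single derived step kills it. This forces the Lie property when the
  n-ary radical is zero.\<close>

lemma squares_n_solvable:
  assumes n: "2 \<le> n"
  shows "leibniz_n_algebra.n_solvable_ideal scale n (U_bracket bracket)
    (span (range (\<lambda>x. bracket x x)))"
proof -
  interpret U: leibniz_n_algebra scale n "U_bracket bracket"
    using n by (rule leibniz_n_algebra_U)
  let ?K = "span (range (\<lambda>x. bracket x x))"
  have right: "bracket x y = 0" if "y \<in> ?K" for x y
    using bracket_span_right[OF subspace_single_0 that] bracket_square_right by auto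
  have left: "bracket y z \<in> ?K" if "y \<in> ?K" for y z
  proof (rule bracket_span_left[OF subspace_span that])
    fix a assume "a \<in> range (\<lambda>x. bracket x x)"
    then obtain x where a: "a = bracket x x" by blast
    let ?b = "bracket x z"
    \<comment> \<open>Polarization: a symmetric sum of brackets is a combination of squares.\<close>
    have "bracket a z = bracket (?b + x) (?b + x) - bracket ?b ?b - bracket x x"
      unfolding a by (subst leibniz_identity) (simp add: bracket_add_left bracket_add_right)
    also have "\<dots> \<in> ?K" by (intro span_diff span_base) auto
    finally show "bracket a z \<in> ?K" .
  qed
  have ideal: "U.n_ideal ?K"
    using n by (rule n_ideal_U) (auto simp: right left span_zero)
  have zero: "U_bracket bracket xs = 0" if "set xs \<subseteq> ?K" "2 \<le> length xs" for xs
    using that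
  proof (induction xs)
    case (Cons x xs)
    show ?case
    proof (cases "2 \<le> length xs")
      case True
      moreover from this have "xs \<noteq> []" by auto
      ultimately show ?thesis using Cons by (simp add: U_bracket_Cons)
    next
      case False
      then obtain y where "xs = [y]"
        using Cons.prems by (cases xs) (auto simp: neq_Nil_conv not_le)
      then show ?thesis using Cons.prems right by simp
    qed
  qed simp
  have "{U_bracket bracket xs | xs. length xs = n \<and> set xs \<subseteq> ?K} \<subseteq> {0}"
    using zero n by blast
  then have "U.n_derived ?K 1 \<subseteq> {0}"
    using span_minimal[OF _ subspace_single_0] by simp
  then have "U.n_derived ?K 1 = {0}"
    using subspace_0[OF U.subspace_n_derived[OF subspace_span]] by blast
  then show ?thesis
    using ideal unfolding U.n_solvable_ideal_def by blast
qed

end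


section \<open>The two derived series of a Lie algebra\<close>

context lie_algebra
begin

lemma bracket_swap: "bracket y x = - bracket x y"
proof -
  have "bracket y x + bracket x y = 0"
    using bracket_self[of "x + y"] bracket_self[of x] bracket_self[of y]
    by (simp add: bracket_add_left bracket_add_right add.commute)
  then show ?thesis by (rule eq_neg_iff_add_eq_0[THEN iffD2])
qed

lemma lie_ideal_of_right:
  assumes "subspace I" and "\<And>x y. x \<in> I \<Longrightarrow> bracket x y \<in> I"
  shows "lie_ideal I"
  unfolding lie_ideal_def
proof (intro conjI allI ballI)
  fix x y assume "y \<in> I"
  then show "bracket x y \<in> I"
    using subspace_neg[OF assms(1) assms(2)] by (subst bracket_swap) blast
qed (use assms in auto)

lemma subspace_lie_derived: "subspace H \<Longrightarrow> subspace (lie_derived H m)"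
  by (cases m) auto

lemma lie_derived_mono: "H \<subseteq> K \<Longrightarrow> lie_derived H m \<subseteq> lie_derived K m"
proof (induction m)
  case (Suc m)
  then show ?case by (auto intro!: span_mono)
qed simp

lemma lie_derived_add: "lie_derived H (m + k) = lie_derived (lie_derived H m) k"
  by (induction k) auto

lemma bracket_lie_derived:
  "x \<in> lie_derived H m \<Longrightarrow> y \<in> lie_derived H m \<Longrightarrow> bracket x y \<in> lie_derived H (Suc m)"
  by (auto intro!: span_base)

lemma lie_derived_Suc_subset:
  assumes H: "subspace H" "\<And>x y. x \<in> H \<Longrightarrow> y \<in> H \<Longrightarrow> bracket x y \<in> H"
  shows "lie_derived H (Suc m) \<subseteq> lie_derived H m"
proof (induction m)
  case 0
  have "{bracket x y | x y. x \<in> H \<and> y \<in> H} \<subseteq> H" using H(2) by blast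
  then show ?case using span_minimal[OF _ H(1)] by simp
next
  case (Suc m)
  then show ?case
    by (simp only: lie_derived.simps(2)[of H "Suc m"] lie_derived.simps(2)[of H m])
      (rule span_mono, blast)
qed

lemma lie_derived_subset:
  assumes "subspace H" "\<And>x y. x \<in> H \<Longrightarrow> y \<in> H \<Longrightarrow> bracket x y \<in> H"
  shows "lie_derived H m \<subseteq> H"
  using lie_derived_Suc_subset[OF assms] by (induction m) auto

lemma lie_derived_closed:
  assumes "subspace H" "\<And>x y. x \<in> H \<Longrightarrow> y \<in> H \<Longrightarrow> bracket x y \<in> H"
    and "x \<in> lie_derived H m" "y \<in> lie_derived H m"
  shows "bracket x y \<in> lie_derived H m"
  using lie_derived_Suc_subset[OF assms(1,2)] bracket_lie_derived[OF assms(3,4)] by blast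

lemma n_derived_subset_lie_derived:
  assumes n: "2 \<le> n"
    and H: "subspace H" "\<And>x y. x \<in> H \<Longrightarrow> y \<in> H \<Longrightarrow> bracket x y \<in> H"
  shows "leibniz_n_algebra.n_derived scale n (U_bracket bracket) H m \<subseteq> lie_derived H m"
proof -
  interpret U: leibniz_n_algebra scale n "U_bracket bracket"
    using n by (rule leibniz_n_algebra_U)
  show ?thesis
  proof (induction m)
    case (Suc m)
    have "U_bracket bracket xs \<in> lie_derived H (Suc m)"
      if "set xs \<subseteq> lie_derived H m" "2 \<le> length xs" for xs
      using that
    proof (induction xs)
      case (Cons x xs)
      show ?case
      proof (cases "2 \<le> length xs")
        case True
        then have "U_bracket bracket xs \<in> lie_derived H (Suc m)" using Cons by simp
        then have "U_bracket bracket xs \<in> lie_derived H m"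
          using lie_derived_Suc_subset[OF H] by blast
        moreover have "xs \<noteq> []" using True by auto
        ultimately show ?thesis
          using Cons.prems bracket_lie_derived[of x H m] by (simp add: U_bracket_Cons)
      next
        case False
        then obtain y where "xs = [y]"
          using Cons.prems by (cases xs) (auto simp: neq_Nil_conv not_le)
        then show ?thesis using Cons.prems bracket_lie_derived[of x H m y] by simp
      qed
    qed simp
    then have "{U_bracket bracket xs | xs. length xs = n \<and> set xs \<subseteq> U.n_derived H m}
        \<subseteq> lie_derived H (Suc m)"
      using Suc.IH n by blast
    then show ?case
      using span_minimal[OF _ subspace_lie_derived[OF H(1), of "Suc m"]] by simp
  qed simp
qed

lemma lie_derived_subset_nested:
  assumes H: "subspace H" "\<And>x y. x \<in> H \<Longrightarrow> y \<in> H \<Longrightarrow> bracket x y \<in> H"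
  shows "lie_derived H k \<subseteq> span {U_bracket bracket xs | xs. length xs = Suc k \<and> set xs \<subseteq> H}"
proof (induction k)
  case 0
  have "H \<subseteq> {U_bracket bracket xs | xs. length xs = Suc 0 \<and> set xs \<subseteq> H}"
  proof
    fix x assume "x \<in> H"
    then show "x \<in> {U_bracket bracket xs | xs. length xs = Suc 0 \<and> set xs \<subseteq> H}"
      by (intro CollectI exI[of _ "[x]"]) auto
  qed
  then show ?case
    unfolding lie_derived.simps using span_superset by (rule subset_trans)
next
  case (Suc k)
  let ?S = "span {U_bracket bracket xs | xs. length xs = Suc (Suc k) \<and> set xs \<subseteq> H}"
  have "bracket x y \<in> ?S" if x: "x \<in> lie_derived H k" and y: "y \<in> lie_derived H k" for x y
  proof (rule bracket_span_right[OF subspace_span subsetD[OF Suc.IH y]])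
    fix b assume "b \<in> {U_bracket bracket xs | xs. length xs = Suc k \<and> set xs \<subseteq> H}"
    then obtain xs where xs: "b = U_bracket bracket xs" "length xs = Suc k" "set xs \<subseteq> H" by blast
    have "x \<in> H" using x lie_derived_subset[OF H] by blast
    moreover have "bracket x b = U_bracket bracket (x # xs)"
      using xs by (subst U_bracket_Cons) auto
    ultimately show "bracket x b \<in> ?S"
      using xs by (intro span_base CollectI exI[of _ "x # xs"]) auto
  qed
  then have "{bracket x y | x y. x \<in> lie_derived H k \<and> y \<in> lie_derived H k} \<subseteq> ?S" by blast
  then show ?case
    unfolding lie_derived.simps using subspace_span by (rule span_minimal)
qed

text \<open>One step of the n-ary series dominates \<open>n - 1\<close> steps of the binary one: the derived
  series descends at least as fast as the lower central series, whose \<open>n\<close>-th term is spanned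
  by the nested n-fold brackets. So for subalgebras both notions of solvability agree.\<close>

lemma lie_derived_subset_n_derived:
  assumes n: "2 \<le> n"
    and H: "subspace H" "\<And>x y. x \<in> H \<Longrightarrow> y \<in> H \<Longrightarrow> bracket x y \<in> H"
  shows "lie_derived H (m * (n - 1)) \<subseteq> leibniz_n_algebra.n_derived scale n (U_bracket bracket) H m"
proof -
  interpret U: leibniz_n_algebra scale n "U_bracket bracket"
    using n by (rule leibniz_n_algebra_U)
  show ?thesis
  proof (induction m)
    case (Suc m)
    let ?D = "lie_derived H (m * (n - 1))"
    have "lie_derived ?D (n - 1) \<subseteq> U.n_derived ?D 1"
      using lie_derived_subset_nested[of ?D "n - 1"] subspace_lie_derived[OF H(1)]
        lie_derived_closed[OF H] n by simp
    also have "\<dots> \<subseteq> U.n_derived (U.n_derived H m) 1"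
      by (rule U.n_derived_mono) (rule Suc.IH)
    also have "\<dots> = U.n_derived H (Suc m)" by simp
    finally show ?case by (simp add: lie_derived_add[symmetric] add.commute)
  qed simp
qed

lemma lie_solvable_of_n_solvable:
  assumes n: "2 \<le> n"
    and H: "subspace H" "\<And>x y. x \<in> H \<Longrightarrow> y \<in> H \<Longrightarrow> bracket x y \<in> H"
    and m: "leibniz_n_algebra.n_derived scale n (U_bracket bracket) H m \<subseteq> {0}"
  shows "\<exists>k. lie_derived H k = {0}"
  using lie_derived_subset_n_derived[OF n H, of m] m
    subspace_0[OF subspace_lie_derived[OF H(1), of "m * (n - 1)"]] by blast

end


section \<open>Derivations and solvable ideals in characteristic zero\<close>

locale fd_lie_algebra_char_0 =
  lie_algebra scale bracket + finite_dimensional_vector_space scale Basis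
  for scale :: "'k::field_char_0 \<Rightarrow> 'v::ab_group_add \<Rightarrow> 'v" and bracket :: "'v \<Rightarrow> 'v \<Rightarrow> 'v"
    and Basis :: "'v set"
begin

text \<open>Ideals of a subalgebra \<open>P\<close>; one side suffices by antisymmetry.\<close>

definition ideal_of :: "'v set \<Rightarrow> 'v set \<Rightarrow> bool" where
  "ideal_of P R \<longleftrightarrow> subspace R \<and> R \<subseteq> P \<and> (\<forall>r\<in>R. \<forall>p\<in>P. bracket r p \<in> R)"

lemma ideal_of_left: "ideal_of P R \<Longrightarrow> r \<in> R \<Longrightarrow> p \<in> P \<Longrightarrow> bracket p r \<in> R"
  using subspace_neg by (auto simp: ideal_of_def bracket_swap[of p r])

text \<open>The divided powers \<open>d\<^sup>j / j!\<close> of \<open>d = [_, z]\<close>, for which the higher Leibniz rule carries no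
  binomial coefficients.\<close>

primrec divpow :: "'v \<Rightarrow> nat \<Rightarrow> 'v \<Rightarrow> 'v" where
  "divpow z 0 x = x"
| "divpow z (Suc j) x = scale (inverse (of_nat (Suc j))) (bracket (divpow z j x) z)"

lemma bracket_divpow: "bracket (divpow z j x) z = scale (of_nat (Suc j)) (divpow z (Suc j) x)"
  by (simp del: of_nat_Suc)

lemma divpow_add: "divpow z j (x + y) = divpow z j x + divpow z j y"
  by (induction j) (simp_all add: bracket_add_left scale_right_distrib)

lemma divpow_scale: "divpow z j (scale c x) = scale c (divpow z j x)"
  by (induction j) (simp_all add: bracket_scale_left mult.commute)

lemma divpow_zero: "divpow z j 0 = 0"
  using divpow_scale[of z j 0 0] by simp

lemma divpow_in:
  assumes "lie_ideal P" "x \<in> P"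
  shows "divpow z j x \<in> P"
  using assms by (induction j) (auto simp: lie_ideal_def subspace_scale)

lemma divpow_bracket:
  "divpow z m (bracket x y) = (\<Sum>a\<le>m. bracket (divpow z a x) (divpow z (m - a) y))"
proof (induction m)
  case (Suc m)
  interpret D: Vector_Spaces.linear scale scale "\<lambda>x. bracket x z" by (rule linear_left)
  let ?t = "\<lambda>a. bracket (divpow z a x) (divpow z (Suc m - a) y)"
  have "bracket (divpow z m (bracket x y)) z
      = (\<Sum>a\<le>m. bracket (bracket (divpow z a x) z) (divpow z (m - a) y)
          + bracket (divpow z a x) (bracket (divpow z (m - a) y) z))"
    unfolding Suc.IH D.sum by (rule sum.cong[OF refl]) (rule leibniz_identity)
  also have "\<dots> = (\<Sum>a\<le>m. scale (of_nat (Suc a)) (?t (Suc a)))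
      + (\<Sum>a\<le>m. scale (of_nat (Suc m - a)) (?t a))"
    unfolding sum.distrib
    by (intro arg_cong2[of _ _ _ _ "(+)"] sum.cong refl)
      (simp_all only: bracket_divpow bracket_scale_left bracket_scale_right atMost_iff Suc_diff_le
        diff_Suc_Suc)
  also have "(\<Sum>a\<le>m. scale (of_nat (Suc a)) (?t (Suc a)))
      = (\<Sum>a\<le>Suc m. scale (of_nat a) (?t a))"
    by (subst sum.atMost_Suc_shift) simp
  also have "(\<Sum>a\<le>m. scale (of_nat (Suc m - a)) (?t a))
      = (\<Sum>a\<le>Suc m. scale (of_nat (Suc m - a)) (?t a))"
    by simp
  also have "(\<Sum>a\<le>Suc m. scale (of_nat a) (?t a)) + (\<Sum>a\<le>Suc m. scale (of_nat (Suc m - a)) (?t a))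
      = (\<Sum>a\<le>Suc m. scale (of_nat (Suc m)) (?t a))"
    unfolding sum.distrib[symmetric] scale_left_distrib[symmetric] of_nat_add[symmetric]
    by (rule sum.cong) auto
  finally have "scale (of_nat (Suc m)) (divpow z (Suc m) (bracket x y))
      = scale (of_nat (Suc m)) (\<Sum>a\<le>Suc m. ?t a)"
    by (simp only: bracket_divpow scale_sum_right)
  then show ?case
    by (simp only: scale_cancel_left of_nat_eq_0_iff) simp
qed simp

text \<open>If \<open>u\<close> and \<open>v\<close> need at least \<open>N\<close> derivatives to leave \<open>R\<close>, then in the Leibniz expansion of
  \<open>2N\<close> derivatives of \<open>[u, v]\<close> only the middle term can leave \<open>R\<close>.\<close>

lemma divpow_bracket_middle:
  assumes P: "lie_ideal P" and R: "ideal_of P R" and "u \<in> P" "v \<in> P"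
    and u: "\<And>j. j < N \<Longrightarrow> divpow z j u \<in> R" and v: "\<And>j. j < N \<Longrightarrow> divpow z j v \<in> R"
  shows "j < 2 * N \<Longrightarrow> divpow z j (bracket u v) \<in> R"
    and "divpow z (2 * N) (bracket u v) - bracket (divpow z N u) (divpow z N v) \<in> R"
proof -
  have sR: "subspace R" using R by (simp add: ideal_of_def)
  have term_in: "bracket (divpow z a u) (divpow z b v) \<in> R" if "a < N \<or> b < N" for a b
    using that R u[of a] v[of b] ideal_of_left[OF R] divpow_in[OF P \<open>u \<in> P\<close>]
      divpow_in[OF P \<open>v \<in> P\<close>] by (auto simp: ideal_of_def)
  show "divpow z j (bracket u v) \<in> R" if "j < 2 * N"
    unfolding divpow_bracket using that
    by (intro subspace_sum[OF sR] term_in) auto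
  have "divpow z (2 * N) (bracket u v) - bracket (divpow z N u) (divpow z N v)
      = (\<Sum>a\<in>{..2 * N} - {N}. bracket (divpow z a u) (divpow z (2 * N - a) v))"
    unfolding divpow_bracket by (subst sum.remove[of _ N]) auto
  also have "\<dots> \<in> R"
    by (intro subspace_sum[OF sR] term_in) auto
  finally show "divpow z (2 * N) (bracket u v) - bracket (divpow z N u) (divpow z N v) \<in> R" .
qed

lemma ideal_of_plus_derivative:
  assumes P: "lie_ideal P" and R: "ideal_of P R"
  shows "ideal_of P {bracket u z + r | u r. u \<in> R \<and> r \<in> R}" (is "ideal_of P ?T")
proof -
  have sR: "subspace R" and sP: "subspace P" and RP: "R \<subseteq> P"
    using P R by (auto simp: ideal_of_def lie_ideal_def)
  have "subspace ?T"
  proof (rule subspaceI)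
    show "0 \<in> ?T" using subspace_0[OF sR] by (force intro!: exI[of _ 0])
  next
    fix x y assume "x \<in> ?T" "y \<in> ?T"
    then obtain u r u' r' where "x = bracket u z + r" "y = bracket u' z + r'"
      "u \<in> R" "r \<in> R" "u' \<in> R" "r' \<in> R" by blast
    then show "x + y \<in> ?T"
      using subspace_add[OF sR]
      by (intro CollectI exI[of _ "u + u'"] exI[of _ "r + r'"])
        (auto simp: bracket_add_left algebra_simps)
  next
    fix c x assume "x \<in> ?T"
    then obtain u r where "x = bracket u z + r" "u \<in> R" "r \<in> R" by blast
    then show "scale c x \<in> ?T"
      using subspace_scale[OF sR]
      by (intro CollectI exI[of _ "scale c u"] exI[of _ "scale c r"])
        (auto simp: bracket_scale_left scale_right_distrib)
  qed
  moreover have "?T \<subseteq> P"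
    using P RP by (auto simp: lie_ideal_def subset_iff intro!: subspace_add[OF sP])
  moreover have "bracket x p \<in> ?T" if x: "x \<in> ?T" and p: "p \<in> P" for x p
  proof -
    obtain u r where x: "x = bracket u z + r" "u \<in> R" "r \<in> R" using x by blast
    have "bracket z p \<in> P" using P p by (simp add: lie_ideal_def)
    then have "bracket u p \<in> R" "bracket u (bracket z p) + bracket r p \<in> R"
      using R x p by (auto simp: ideal_of_def intro: subspace_add)
    moreover have "bracket x p = bracket (bracket u p) z + (bracket u (bracket z p) + bracket r p)"
      unfolding x bracket_add_left leibniz_identity[of u z p] by (simp add: algebra_simps)
    ultimately show ?thesis by blast
  qed
  ultimately show ?thesis by (auto simp: ideal_of_def)
qed

text \<open>Modulo \<open>R\<close>, an element of the \<open>k\<close>-th derived term of \<open>R + dR\<close> is a \<open>2\<^sup>k\<close>-th divided power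
  of \<open>d\<close> applied to an element of the \<open>k\<close>-th derived term of \<open>R\<close>; the generators of \<open>R + dR\<close>
  are the case \<open>k = 0\<close>, and brackets are handled by \<open>divpow_bracket_middle\<close>.\<close>

lemma lie_derived_plus_derivative:
  assumes P: "lie_ideal P" and R: "ideal_of P R"
  shows "lie_derived {bracket u z + r | u r. u \<in> R \<and> r \<in> R} k
    \<subseteq> {divpow z (2 ^ k) u + r | u r.
        u \<in> lie_derived R k \<and> (\<forall>j < 2 ^ k. divpow z j u \<in> R) \<and> r \<in> R}"
    (is "lie_derived ?T k \<subseteq> ?G k")
proof (induction k)
  case 0
  then show ?case by auto
next
  case (Suc k)
  have sR: "subspace R" and RP: "R \<subseteq> P"
    using R by (auto simp: ideal_of_def)
  have RR: "\<And>x y. x \<in> R \<Longrightarrow> y \<in> R \<Longrightarrow> bracket x y \<in> R"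
    using R by (auto simp: ideal_of_def)
  have DP: "\<And>x. x \<in> lie_derived R k \<Longrightarrow> x \<in> P"
    using lie_derived_subset[OF sR RR] RP by blast
  have sD: "subspace (lie_derived R (Suc k))" by (rule subspace_lie_derived[OF sR])
  have sG: "subspace (?G (Suc k))"
  proof (rule subspaceI)
    show "0 \<in> ?G (Suc k)"
      using subspace_0[OF sR] subspace_0[OF sD]
      by (intro CollectI exI[of _ 0]) (auto simp: divpow_zero)
  next
    fix x y assume "x \<in> ?G (Suc k)" "y \<in> ?G (Suc k)"
    then obtain u r u' r'
      where x: "x = divpow z (2 ^ Suc k) u + r" "u \<in> lie_derived R (Suc k)"
        "\<forall>j < 2 ^ Suc k. divpow z j u \<in> R" "r \<in> R"
        and y: "y = divpow z (2 ^ Suc k) u' + r'" "u' \<in> lie_derived R (Suc k)"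
        "\<forall>j < 2 ^ Suc k. divpow z j u' \<in> R" "r' \<in> R"
      by blast
    have "x + y = divpow z (2 ^ Suc k) (u + u') + (r + r')"
      unfolding x y divpow_add by (simp only: add_ac)
    moreover have "\<forall>j < 2 ^ Suc k. divpow z j (u + u') \<in> R"
      using x y subspace_add[OF sR] by (simp only: divpow_add) blast
    ultimately show "x + y \<in> ?G (Suc k)"
      using x y subspace_add[OF sR] subspace_add[OF sD] by blast
  next
    fix c x assume "x \<in> ?G (Suc k)"
    then obtain u r where x: "x = divpow z (2 ^ Suc k) u + r" "u \<in> lie_derived R (Suc k)"
        "\<forall>j < 2 ^ Suc k. divpow z j u \<in> R" "r \<in> R"
      by blast
    have "scale c x = divpow z (2 ^ Suc k) (scale c u) + scale c r"
      unfolding x divpow_scale by (simp only: scale_right_distrib)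
    moreover have "\<forall>j < 2 ^ Suc k. divpow z j (scale c u) \<in> R"
      using x subspace_scale[OF sR] by (simp only: divpow_scale) blast
    ultimately show "scale c x \<in> ?G (Suc k)"
      using x subspace_scale[OF sR] subspace_scale[OF sD] by blast
  qed
  have step: "bracket x y \<in> ?G (Suc k)" if "x \<in> ?G k" "y \<in> ?G k" for x y
  proof -
    let ?N = "2 ^ k :: nat"
    obtain u r v s
      where x: "x = divpow z ?N u + r" "u \<in> lie_derived R k" "\<And>j. j < ?N \<Longrightarrow> divpow z j u \<in> R" "r \<in> R"
        and y: "y = divpow z ?N v + s" "v \<in> lie_derived R k" "\<And>j. j < ?N \<Longrightarrow> divpow z j v \<in> R" "s \<in> R"
      using \<open>x \<in> ?G k\<close> \<open>y \<in> ?G k\<close> by blast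
    note middle = divpow_bracket_middle[OF P R DP[OF x(2)] DP[OF y(2)], of ?N]
    let ?e = "bracket (divpow z ?N u) s + bracket r (divpow z ?N v) + bracket r s"
    let ?f = "divpow z (2 * ?N) (bracket u v) - bracket (divpow z ?N u) (divpow z ?N v)"
    have f: "?f \<in> R"
      by (rule middle(2)) (fact x(3), fact y(3))
    have "?e \<in> R"
      using R RR x(4) y(4) divpow_in[OF P DP[OF x(2)]] divpow_in[OF P DP[OF y(2)]]
        ideal_of_left[OF R]
      by (intro subspace_add[OF sR]) (auto simp: ideal_of_def)
    then have "?e - ?f \<in> R"
      using f by (rule subspace_diff[OF sR])
    moreover have "bracket x y = divpow z (2 ^ Suc k) (bracket u v) + (?e - ?f)"
      unfolding x(1) y(1) by (simp add: bracket_add_left bracket_add_right algebra_simps)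
    moreover have "\<forall>j < 2 ^ Suc k. divpow z j (bracket u v) \<in> R"
    proof (intro allI impI)
      fix j :: nat assume "j < 2 ^ Suc k"
      then have "j < 2 * ?N" by simp
      show "divpow z j (bracket u v) \<in> R"
        by (rule middle(1)) (fact x(3), fact y(3), fact \<open>j < 2 * ?N\<close>)
    qed
    moreover note bracket_lie_derived[OF x(2) y(2)]
    ultimately show ?thesis
      by (intro CollectI exI[of _ "bracket u v"] exI[of _ "?e - ?f"] conjI)
  qed
  have "{bracket x y | x y. x \<in> lie_derived ?T k \<and> y \<in> lie_derived ?T k} \<subseteq> ?G (Suc k)"
  proof
    fix w assume "w \<in> {bracket x y | x y. x \<in> lie_derived ?T k \<and> y \<in> lie_derived ?T k}"
    then obtain x y where w: "w = bracket x y" "x \<in> lie_derived ?T k" "y \<in> lie_derived ?T k"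
      by blast
    show "w \<in> ?G (Suc k)"
      unfolding w(1) by (rule step) (fact subsetD[OF Suc.IH w(2)], fact subsetD[OF Suc.IH w(3)])
  qed
  then show ?case
    using span_minimal[OF _ sG] by (simp only: lie_derived.simps)
qed

text \<open>The radical of an ideal \<open>P\<close> is stable under \<open>d = [_, z]\<close>: if \<open>R\<close> is a solvable ideal of \<open>P\<close>,
  so is \<open>R + dR\<close>, because its derived series enters \<open>R\<close>. A solvable ideal \<open>R\<close> of \<open>P\<close> of greatest
  dimension is therefore an ideal of the whole algebra.\<close>

lemma ideal_of_solvable_zero:
  assumes rad: "\<And>I. lie_solvable_ideal I \<Longrightarrow> I \<subseteq> {0}"
    and P: "lie_ideal P" and J: "ideal_of P J" "lie_derived J m = {0}"
  shows "J \<subseteq> {0}"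
proof -
  let ?Q = "\<lambda>R. ideal_of P R \<and> (\<exists>k. lie_derived R k = {0})"
  have "\<exists>R. ?Q R \<and> (\<forall>I. ?Q I \<longrightarrow> dim I \<le> dim R)"
    using ex_has_greatest_nat[of ?Q J dim "Suc dimension"] J dim_subset_UNIV
    by (meson le_imp_less_Suc less_imp_le)
  then obtain R k where R: "ideal_of P R" and k: "lie_derived R k = {0}"
    and max: "\<And>I. ?Q I \<Longrightarrow> dim I \<le> dim R" by blast
  have sR: "subspace R" using R by (simp add: ideal_of_def)
  have "bracket y z \<in> R" if y: "y \<in> R" for y z
  proof -
    let ?T = "{bracket u z + r | u r. u \<in> R \<and> r \<in> R}"
    have T: "ideal_of P ?T" by (rule ideal_of_plus_derivative[OF P R])
    then have sT: "subspace ?T" by (simp add: ideal_of_def)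
    have "lie_derived ?T k \<subseteq> R"
      using lie_derived_plus_derivative[OF P R, of z k] k by (auto simp: divpow_zero)
    then have "lie_derived ?T (k + k) \<subseteq> {0}"
      using lie_derived_mono[of "lie_derived ?T k" R k] k by (simp add: lie_derived_add)
    then have "lie_derived ?T (k + k) = {0}"
      using subspace_0[OF subspace_lie_derived[OF sT]] by blast
    then have "dim ?T \<le> dim R" using max T by blast
    moreover have "R \<subseteq> ?T"
    proof
      fix r assume "r \<in> R"
      then show "r \<in> ?T"
        using subspace_0[OF sR] by (intro CollectI exI[of _ 0] exI[of _ r]) simp
    qed
    ultimately have "R = ?T" using subspace_dim_equal[OF sR sT] by blast
    moreover have "bracket y z \<in> ?T"
      using y subspace_0[OF sR] by (intro CollectI exI[of _ y] exI[of _ 0]) simp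
    ultimately show ?thesis by simp
  qed
  then have "lie_ideal R"
    using sR by (rule lie_ideal_of_right[rotated])
  then have "lie_solvable_ideal R"
    using k unfolding lie_solvable_ideal_def by blast
  then have "dim R = 0" using rad dim_eq_0 by blast
  then have "dim J = 0" using max J by (metis le_zero_eq)
  then show ?thesis using dim_eq_0 by blast
qed


section \<open>Semisimplicity\<close>

text \<open>Let \<open>P\<close> be spanned by the nested \<open>(n - 1)\<close>-fold brackets. An n-ideal \<open>I\<close> is not
  visibly an ideal, but \<open>[I, P] \<subseteq> I\<close>. So \<open>I \<inter> P\<close> is a solvable ideal of \<open>P\<close>, hence zero, and \<open>I\<close> lies in the
  centralizer of \<open>P\<close>; this centralizer is an ideal, and n-fold brackets of its elements vanish.\<close>

lemma n_solvable_zero_if_no_lie_solvable: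
  assumes n: "2 \<le> n" and rad: "\<And>I. lie_solvable_ideal I \<Longrightarrow> I \<subseteq> {0}"
    and I: "leibniz_n_algebra.n_solvable_ideal scale n (U_bracket bracket) I"
  shows "I \<subseteq> {0}"
proof -
  interpret U: leibniz_n_algebra scale n "U_bracket bracket"
    using n by (rule leibniz_n_algebra_U)
  obtain m where nI: "U.n_ideal I" and m: "U.n_derived I m = {0}"
    using I by (auto simp: U.n_solvable_ideal_def)
  have sI: "subspace I" using nI by (simp add: U.n_ideal_def)
  let ?A = "{U_bracket bracket xs | xs. length xs = n - 1}"
  let ?P = "span ?A"
  have right: "bracket p y \<in> ?P" if "p \<in> ?P" for p y
  proof (rule bracket_span_left[OF subspace_span that])
    fix a assume "a \<in> ?A"
    then obtain xs where xs: "a = U_bracket bracket xs" "length xs = n - 1" by blast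
    then have "xs \<noteq> []" using n by auto
    then have "bracket a y = (\<Sum>i<n - 1. U_bracket bracket (xs[i := bracket (xs ! i) y]))"
      unfolding xs(1) xs(2)[symmetric] by (rule derivation_U_bracket)
    also have "\<dots> \<in> ?P"
      by (rule span_sum, rule span_base, rule CollectI, rule exI, rule conjI[OF refl])
        (simp add: xs)
    finally show "bracket a y \<in> ?P" .
  qed
  then have P: "lie_ideal ?P"
    by (rule lie_ideal_of_right[OF subspace_span])
  have IP: "bracket x p \<in> I" if x: "x \<in> I" and p: "p \<in> ?P" for x p
  proof (rule bracket_span_right[OF sI p])
    fix a assume "a \<in> ?A"
    then obtain xs where xs: "a = U_bracket bracket xs" "length xs = n - 1" by blast
    have "\<forall>zs. length zs = n \<longrightarrow> zs ! 0 \<in> I \<longrightarrow> U_bracket bracket zs \<in> I"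
      using nI n unfolding U.n_ideal_def by (metis pos2 less_le_trans)
    then have "U_bracket bracket (x # xs) \<in> I" using xs x n by simp
    moreover have "xs \<noteq> []" using xs n by auto
    ultimately show "bracket x a \<in> I" by (simp add: xs U_bracket_Cons)
  qed
  have IP_ideal: "ideal_of ?P (I \<inter> ?P)"
    unfolding ideal_of_def
  proof (intro conjI ballI IntI)
    show "subspace (I \<inter> ?P)" by (rule subspace_inter[OF sI subspace_span])
  qed (use IP right in \<open>blast+\<close>)
  have "\<exists>k. lie_derived (I \<inter> ?P) k = {0}"
  proof (rule lie_solvable_of_n_solvable[OF n])
    show "subspace (I \<inter> ?P)" by (rule subspace_inter[OF sI subspace_span])
    show "bracket x y \<in> I \<inter> ?P" if "x \<in> I \<inter> ?P" "y \<in> I \<inter> ?P" for x y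
      using that IP right by blast
    show "U.n_derived (I \<inter> ?P) m \<subseteq> {0}"
      unfolding m[symmetric] by (rule U.n_derived_mono) (rule Int_lower1)
  qed
  then have inter: "I \<inter> ?P \<subseteq> {0}"
    using ideal_of_solvable_zero[OF rad P IP_ideal] by blast
  let ?C = "{x. \<forall>p\<in>?P. bracket x p = 0}"
  have IC: "I \<subseteq> ?C"
  proof (intro subsetI CollectI ballI)
    fix x p assume x: "x \<in> I" and p: "p \<in> ?P"
    have "bracket x p \<in> ?P" using P p by (simp add: lie_ideal_def)
    then show "bracket x p = 0" using IP[OF x p] inter by blast
  qed
  have sC: "subspace ?C"
    by (rule subspaceI) (auto simp: bracket_add_left bracket_scale_left)
  have C: "lie_ideal ?C"
  proof (rule lie_ideal_of_right[OF sC], rule CollectI, rule ballI)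
    fix x y p assume x: "x \<in> ?C" and p: "p \<in> ?P"
    have "bracket y p \<in> ?P" using P p by (simp add: lie_ideal_def)
    then show "bracket (bracket x y) p = 0"
      using x p by (simp add: leibniz_identity[of x y p])
  qed
  have "U_bracket bracket xs = 0" if xs: "length xs = n" "set xs \<subseteq> ?C" for xs
  proof -
    obtain x ys where ys: "xs = x # ys" using xs n by (cases xs) auto
    then have "length ys = n - 1" using xs by simp
    then have "U_bracket bracket ys \<in> ?P" by (intro span_base) blast
    moreover have "ys \<noteq> []" using xs ys n by auto
    moreover have "x \<in> ?C" using xs(2) by (simp add: ys)
    ultimately show ?thesis by (simp add: ys U_bracket_Cons)
  qed
  then have "{U_bracket bracket xs | xs. length xs = n \<and> set xs \<subseteq> ?C} \<subseteq> {0}"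
    by blast
  then have "U.n_derived ?C 1 \<subseteq> {0}"
    using span_minimal[OF _ subspace_single_0] by simp
  then have "\<exists>k. lie_derived ?C k = {0}"
    by (rule lie_solvable_of_n_solvable[OF n sC, rotated]) (use C in \<open>simp add: lie_ideal_def\<close>)
  then have "?C \<subseteq> {0}"
    using C by (intro rad) (simp add: lie_solvable_ideal_def)
  then show ?thesis using IC by (rule subset_trans[rotated])
qed

lemma n_solvable_ideal_lie_Rad:
  assumes n: "2 \<le> n"
  shows "leibniz_n_algebra.n_solvable_ideal scale n (U_bracket bracket) lie_Rad"
proof -
  interpret U: leibniz_n_algebra scale n "U_bracket bracket"
    using n by (rule leibniz_n_algebra_U)
  have "lie_solvable_ideal lie_Rad"
    using is_lie_Rad[OF finite_dimensional_vector_space_axioms] by blast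
  then obtain m where R: "lie_ideal lie_Rad" and m: "lie_derived lie_Rad m = {0}"
    by (auto simp: lie_solvable_ideal_def)
  then have sR: "subspace lie_Rad" by (simp add: lie_ideal_def)
  have "U.n_ideal lie_Rad"
    using R by (intro n_ideal_U[OF n]) (auto simp: lie_ideal_def)
  moreover have "U.n_derived lie_Rad m \<subseteq> {0}"
    using n_derived_subset_lie_derived[OF n sR, of m] R m by (auto simp: lie_ideal_def)
  then have "U.n_derived lie_Rad m = {0}"
    using subspace_0[OF U.subspace_n_derived[OF sR]] by blast
  ultimately show ?thesis unfolding U.n_solvable_ideal_def by blast
qed

end

theorem mainTheorem4:
  fixes scale :: "'k::field_char_0 \<Rightarrow> 'v::ab_group_add \<Rightarrow> 'v"
    and bracket :: "'v \<Rightarrow> 'v \<Rightarrow> 'v" and Basis :: "'v set" and n :: nat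
  assumes "n \<ge> 2"
    and "finite_dimensional_vector_space scale Basis"
    and "leibniz_algebra scale bracket"
  shows "leibniz_n_algebra.semisimple scale n (U_bracket bracket) \<longleftrightarrow>
    semisimple_lie_algebra scale bracket"
proof -
  interpret L: leibniz_algebra scale bracket by fact
  interpret U: leibniz_n_algebra scale n "U_bracket bracket"
    using assms(1) by (rule L.leibniz_n_algebra_U)
  have Rad: "U.n_solvable_ideal U.Rad" and Rad_max: "\<And>I. U.n_solvable_ideal I \<Longrightarrow> I \<subseteq> U.Rad"
    using U.is_Rad[OF assms(2)] by blast+
  show ?thesis
  proof
    assume "U.semisimple"
    then have Rad_zero: "U.Rad = {0}" by (simp only: U.semisimple_def)
    have "bracket x x = 0" for x
    proof -
      have "bracket x x \<in> U.Rad"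
        by (rule subsetD[OF Rad_max[OF L.squares_n_solvable[OF assms(1)]]])
          (rule L.span_base, rule rangeI)
      then show ?thesis by (simp only: Rad_zero singleton_iff)
    qed
    then interpret lie_algebra scale bracket by unfold_locales
    interpret fd_lie_algebra_char_0 scale bracket Basis
      by (intro fd_lie_algebra_char_0.intro lie_algebra_axioms assms(2))
    have "lie_Rad \<subseteq> {0}"
      using Rad_max[OF n_solvable_ideal_lie_Rad[OF assms(1)]] by (simp only: Rad_zero)
    moreover have "lie_ideal lie_Rad"
      using is_lie_Rad[OF assms(2)] by (simp only: lie_solvable_ideal_def)
    then have "0 \<in> lie_Rad" unfolding lie_ideal_def by (blast intro: L.subspace_0)
    ultimately have "lie_Rad = {0}" by blast
    then show "semisimple_lie_algebra scale bracket"
      by (intro semisimple_lie_algebra.intro lie_algebra_axioms semisimple_lie_algebra_axioms.intro)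
  next
    assume "semisimple_lie_algebra scale bracket"
    then interpret S: semisimple_lie_algebra scale bracket .
    interpret fd_lie_algebra_char_0 scale bracket Basis
      by (intro fd_lie_algebra_char_0.intro S.lie_algebra_axioms assms(2))
    have "I \<subseteq> {0}" if "S.lie_solvable_ideal I" for I
      using S.is_lie_Rad[OF assms(2)] that unfolding S.lie_Rad_zero by blast
    then have "U.Rad \<subseteq> {0}"
      using Rad by (rule n_solvable_zero_if_no_lie_solvable[OF assms(1)])
    moreover have "0 \<in> U.Rad"
      using Rad unfolding U.n_solvable_ideal_def U.n_ideal_def by (blast intro: L.subspace_0)
    ultimately show "U.semisimple" unfolding U.semisimple_def by blast
  qed
qed

end
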